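(* Let $X$ be an infinite set, $G$ an inverse subsemigroup of $I_X$, and $\{M_i \mid i \in I\}$ a collection of subsets of $I_X$. Suppose that the following six conditions hold, where $Y$ denotes the same set in (v) and (vi): (i) $G \subseteq M_i$ for all $i \in I$; (ii) $M_i$ is a proper subsemigroup of $I_X$ for all $i \in I$; (iii) $M_i \not\subseteq M_j$ whenever $i \neq j$; (iv) for all $i \in I$ there exists $j \in I$ such that $M_j = M_i^{-1}$; (v) there exists $Y \subseteq X$ such that $|Y| = |X|$ and $\operatorname{Sym}(Y) \subseteq \{ g|_Y \mid g \in G \}$; (vi) for all subsemigroups $U$ of $I_X$ such that $G \subseteq U$ and $U \not\subseteq M_i$ for all $i \in I$, there exists $f \in U$ such that $\operatorname{dom}(f) = X$ and $\operatorname{im}(f)$ is a moiety of $Y$. Then $\{M_i \mid i \in I\}$ is the set of all maximal subsemigroups of $I_X$ containing $G$.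
   Context: For a set $X$, $I_X$ is the symmetric inverse monoid: the set of all bijections between subsets of $X$ (partial bijections, called charts) under composition of partial functions, written left to right, so $x(fg) = (xf)g$ and $\operatorname{dom}(fg)=\{x\in\operatorname{dom}(f) : xf\in\operatorname{dom}(g)\}$. For $A \subseteq I_X$, $A^{-1} = \{f^{-1} \mid f \in A\}$. An inverse subsemigroup of $I_X$ is a subsemigroup closed under $f \mapsto f^{-1}$. $\operatorname{Sym}(Y)$ is the group of all permutations of $Y$. For $g \in I_X$ and $Y\subseteq X$, $g|_Y$ is the restriction of $g$ to $Y \cap \operatorname{dom}(g)$. A moiety of an infinite set $Y$ is a subset $Z\subseteq Y$ with $|Z| = |Y \setminus Z| = |Y|$. A maximal subsemigroup of $I_X$ is a proper subsemigroup that is maximal under containment among the proper subsemigroups of $I_X$. *)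

theory Defs
  imports Main "HOL-Library.Equipollence"
begin

(* Partial functions are represented by their graphs, i.e. as binary relations.
   Relational composition f O g then composes from left to right, the inverse chart
   is the converse relation, and dom and im are Domain and Range. *)

definition graph_on :: "'a set \<Rightarrow> ('a \<Rightarrow> 'b) \<Rightarrow> ('a \<times> 'b) set" where
  "graph_on A h = {(x, h x) | x. x \<in> A}"

definition sym_inv_monoid :: "'a set \<Rightarrow> ('a \<times> 'a) set set" where
  "sym_inv_monoid X = {graph_on A h | A B h. A \<subseteq> X \<and> B \<subseteq> X \<and> bij_betw h A B}"

definition Sym :: "'a set \<Rightarrow> ('a \<times> 'a) set set" where
  "Sym Y = {graph_on Y h | h. bij_betw h Y Y}"

definition restr :: "('a \<times> 'a) set \<Rightarrow> 'a set \<Rightarrow> ('a \<times> 'a) set" where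
  "restr g Y = {(x, y). (x, y) \<in> g \<and> x \<in> Y}"

definition set_inverse :: "('a \<times> 'a) set set \<Rightarrow> ('a \<times> 'a) set set" where
  "set_inverse A = {f\<inverse> | f. f \<in> A}"

definition subsemigroup :: "'a set \<Rightarrow> ('a \<times> 'a) set set \<Rightarrow> bool" where
  "subsemigroup X S \<longleftrightarrow> S \<subseteq> sym_inv_monoid X \<and> (\<forall>f\<in>S. \<forall>g\<in>S. f O g \<in> S)"

definition inverse_subsemigroup :: "'a set \<Rightarrow> ('a \<times> 'a) set set \<Rightarrow> bool" where
  "inverse_subsemigroup X S \<longleftrightarrow> subsemigroup X S \<and> (\<forall>f\<in>S. f\<inverse> \<in> S)"

definition proper_subsemigroup :: "'a set \<Rightarrow> ('a \<times> 'a) set set \<Rightarrow> bool" where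
  "proper_subsemigroup X S \<longleftrightarrow> subsemigroup X S \<and> S \<noteq> sym_inv_monoid X"

definition maximal_subsemigroup :: "'a set \<Rightarrow> ('a \<times> 'a) set set \<Rightarrow> bool" where
  "maximal_subsemigroup X S \<longleftrightarrow>
     proper_subsemigroup X S \<and> (\<forall>T. proper_subsemigroup X T \<and> S \<subseteq> T \<longrightarrow> T = S)"

definition moiety :: "'a set \<Rightarrow> 'a set \<Rightarrow> bool" where
  "moiety Z Y \<longleftrightarrow> Z \<subseteq> Y \<and> Z \<approx> Y \<and> Y - Z \<approx> Y"

lemma sym_inv_monoid_iff:
  "f \<in> sym_inv_monoid X \<longleftrightarrow> f \<subseteq> X \<times> X \<and> single_valued f \<and> single_valued (f\<inverse>)"
proof
  assume "f \<in> sym_inv_monoid X"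
  then show "f \<subseteq> X \<times> X \<and> single_valued f \<and> single_valued (f\<inverse>)"
    by (auto simp: sym_inv_monoid_def graph_on_def single_valued_def bij_betw_def inj_on_def)
next
  assume f: "f \<subseteq> X \<times> X \<and> single_valued f \<and> single_valued (f\<inverse>)"
  define h where "h x = (SOME y. (x, y) \<in> f)" for x
  have h: "(x, y) \<in> f \<longleftrightarrow> x \<in> Domain f \<and> y = h x" for x y
    using f unfolding h_def single_valued_def by (metis Domain.simps someI)
  have "f = graph_on (Domain f) h"
    using h unfolding graph_on_def by auto
  moreover have "bij_betw h (Domain f) (Range f)"
    unfolding bij_betw_def inj_on_def
  proof (intro conjI ballI impI)
    fix x y assume "x \<in> Domain f" "y \<in> Domain f" "h x = h y"
    then have "(x, h x) \<in> f" "(y, h x) \<in> f" using h by auto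
    then show "x = y" using f unfolding single_valued_def by blast
  next
    show "h ` Domain f = Range f" using h by (auto simp: image_iff Range_iff)
  qed
  moreover have "Domain f \<subseteq> X" "Range f \<subseteq> X" using f by auto
  ultimately show "f \<in> sym_inv_monoid X"
    unfolding sym_inv_monoid_def by blast
qed

lemma subsemigroup_sym_inv_monoid: "inverse_subsemigroup X (sym_inv_monoid X)"
  unfolding inverse_subsemigroup_def subsemigroup_def
  by (auto simp: sym_inv_monoid_iff single_valued_def; blast)

end

theory Submission
  imports Defs
begin

text \<open>
  It suffices to see that a subsemigroup \<open>U\<close> containing \<open>G\<close> but contained in no \<open>M i\<close> is everything.
  Condition (vi), applied to \<open>U\<close> and, thanks to (iv), to \<open>U\<inverse>\<close>, gives charts \<open>f\<close> and \<open>t\<close> in \<open>U\<close>,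
  where \<open>f\<close> maps \<open>X\<close> onto a moiety \<open>A\<close> of \<open>Y\<close> and \<open>t\<close> maps a moiety \<open>B\<close> of \<open>Y\<close> onto \<open>X\<close>.
  Given an arbitrary chart \<open>h\<close>, the chart \<open>f\<inverse> h t\<inverse>\<close> extends to a permutation \<open>p\<close> of \<open>Y\<close>
  that sends the points of \<open>A\<close> outside its domain away from \<open>B\<close>, so that \<open>f p t = h\<close>; by (v) the
  permutation \<open>p\<close> is induced by an element of \<open>G\<close>.
\<close>

text \<open>Since \<open>A\<close> is infinite, \<open>B - B'\<close> has room for two disjoint
  copies of \<open>A\<close>. The left copy receives \<open>A'\<close>; the right one stays outside
  \<open>e\<close> A'\<open>, so\<close>B - e \<open>A'\<close> is still as large as
  \<open>B\<close> and can be matched with \<open>A - A'\<close>.\<close>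

lemma ex_bij_betw_image_disjnt:
  assumes "infinite A" "A \<approx> B" "A - A' \<approx> A" "B - B' \<approx> B" "A' \<subseteq> A"
  obtains p where "bij_betw p A B" "p ` A' \<inter> B' = {}"
proof -
  have "A <+> A \<approx> A"
    unfolding eqpoll_def card_of_ordIso
    by (rule card_of_Plus_infinite1[OF assms(1) ordLeq_refl[OF card_of_Card_order]])
  then have "A <+> A \<approx> B - B'"
    using assms(2,4) by (meson eqpoll_sym eqpoll_trans)
  then obtain \<phi> where \<phi>: "bij_betw \<phi> (A <+> A) (B - B')"
    unfolding eqpoll_def by blast
  have inj: "inj_on \<phi> (A <+> A)" and im: "\<phi> ` (A <+> A) = B - B'"
    using \<phi> by (auto simp: bij_betw_def)
  define e where "e x = \<phi> (Inl x)" for x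
  have e: "bij_betw e A' (e ` A')"
    using inj assms(5) unfolding e_def by (intro inj_on_imp_bij_betw) (auto simp: inj_on_def)
  have eB: "e ` A' \<subseteq> B - B'"
    using im assms(5) by (auto simp: e_def)
  have "(\<lambda>x. \<phi> (Inr x)) ` A \<subseteq> B - e ` A'"
    using im inj assms(5) by (auto simp: e_def inj_on_def)
  moreover have "inj_on (\<lambda>x. \<phi> (Inr x)) A"
    using inj by (auto simp: inj_on_def)
  ultimately have "A \<lesssim> B - e ` A'"
    unfolding lepoll_def by blast
  then have "B \<lesssim> B - e ` A'"
    using assms(2) by (meson eqpoll_imp_lepoll eqpoll_sym lepoll_trans)
  then have "B - e ` A' \<approx> B"
    by (simp add: lepoll_antisym subset_imp_lepoll)
  then have "A - A' \<approx> B - e ` A'"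
    using assms(2,3) by (meson eqpoll_sym eqpoll_trans)
  then obtain q where q: "bij_betw q (A - A') (B - e ` A')"
    unfolding eqpoll_def by blast
  define p where "p x = (if x \<in> A' then e x else q x)" for x
  have *: "bij_betw p (A' \<union> (A - A')) (e ` A' \<union> (B - e ` A'))"
    unfolding p_def using bij_betw_disjoint_Un[OF e q] by simp
  have "bij_betw p A B"
  proof -
    have "A' \<union> (A - A') = A" "e ` A' \<union> (B - e ` A') = B"
      using assms(5) eB by auto
    with * show ?thesis by simp
  qed
  moreover have "p ` A' \<inter> B' = {}"
    using eB by (auto simp: p_def)
  ultimately show thesis by (rule that)
qed

lemma graph_on_iff: "(x, y) \<in> graph_on A h \<longleftrightarrow> x \<in> A \<and> y = h x"
  by (auto simp: graph_on_def)

text \<open>Extend \<open>k\<close> by a bijection \<open>q\<close> between the complements of its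
  domain \<open>C\<close> and its image \<open>D\<close>. Sending \<open>A - C\<close> away from
  \<open>B - D\<close> ensures that no new pair falls into \<open>A \<times> B\<close>.\<close>

lemma ex_Sym_extending_chart:
  assumes "infinite Y" "moiety A Y" "moiety B Y"
    and k: "k \<in> sym_inv_monoid Y" "k \<subseteq> A \<times> B"
  obtains p where "p \<in> Sym Y" "p \<inter> A \<times> B = k"
proof -
  obtain C D h where h: "k = graph_on C h" "bij_betw h C D"
    using k(1) unfolding sym_inv_monoid_def by blast
  have CD: "C \<subseteq> A" "D \<subseteq> B"
    using k(2) h by (auto simp: graph_on_def bij_betw_def)
  have A: "A \<subseteq> Y" "Y - A \<approx> Y" and B: "B \<subseteq> Y" "Y - B \<approx> Y"
    using assms by (auto simp: moiety_def)
  have co: "Y - S \<approx> Y" if "S \<subseteq> T" "Y - T \<approx> Y" for S T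
  proof (rule lepoll_antisym)
    show "Y \<lesssim> Y - S"
      using that by (meson Diff_mono eqpoll_imp_lepoll eqpoll_sym lepoll_trans order_refl subset_imp_lepoll)
  qed (simp add: subset_imp_lepoll)
  have C: "Y - C \<approx> Y" and D: "Y - D \<approx> Y"
    using co CD A B by blast+
  \<comment> \<open>This reduces the size conditions for the pairs \<open>A - C\<close>,
    \<open>Y - C\<close> and \<open>B - D\<close>, \<open>Y - D\<close> to the moiety conditions on
    \<open>A\<close> and \<open>B\<close>.\<close>
  have "(Y - C) - (A - C) = Y - A" "(Y - D) - (B - D) = Y - B"
    using CD by auto
  then have "(Y - C) - (A - C) \<approx> Y - C" "(Y - D) - (B - D) \<approx> Y - D"
    using A(2) B(2) C D by (auto intro: eqpoll_trans eqpoll_sym)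
  moreover have "Y - C \<approx> Y - D"
    using C D by (blast intro: eqpoll_trans eqpoll_sym)
  moreover have "infinite (Y - C)"
    using C assms(1) by (simp add: eqpoll_finite_iff)
  moreover have "A - C \<subseteq> Y - C"
    using A(1) by blast
  ultimately obtain q where q: "bij_betw q (Y - C) (Y - D)" "q ` (A - C) \<inter> (B - D) = {}"
    using ex_bij_betw_image_disjnt[of "Y - C" "Y - D" "A - C" "B - D"] by metis
  define p where "p x = (if x \<in> C then h x else q x)" for x
  have "bij_betw p (C \<union> (Y - C)) (D \<union> (Y - D))"
    unfolding p_def using bij_betw_disjoint_Un[OF h(2) q(1)] by simp
  moreover have "C \<union> (Y - C) = Y" "D \<union> (Y - D) = Y"
    using CD A B by auto
  ultimately have p: "bij_betw p Y Y"
    by simp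
  have "q x \<notin> B" if "x \<in> A" "x \<notin> C" for x
    using that q A by (auto simp: bij_betw_def)
  then have "graph_on Y p \<inter> A \<times> B = k"
    using h CD A(1) by (auto simp: graph_on_iff p_def bij_betw_def subset_iff)
  moreover have "graph_on Y p \<in> Sym Y"
    using p by (auto simp: Sym_def)
  ultimately show thesis
    using that by metis
qed

text \<open>Between \<open>f\<close> and \<open>t\<close> only those pairs of \<open>g\<close> count
  that start in \<open>Range f\<close> and end in \<open>Domain t\<close>; they survive restriction
  to \<open>Y\<close>, which contains \<open>Range f\<close>.\<close>

lemma restr_sandwich:
  assumes "Range f \<subseteq> Y" "restr g Y = p"
  shows "f O g O t = f O (p \<inter> Range f \<times> Domain t) O t"
proof (rule set_eqI, clarify)
  fix x y
  show "(x, y) \<in> f O g O t \<longleftrightarrow> (x, y) \<in> f O (p \<inter> Range f \<times> Domain t) O t"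
    using assms by (auto simp: restr_def relcomp_unfold)
qed

text \<open>Here \<open>f O f\<inverse>\<close> and \<open>t\<inverse> O t\<close> are both the
  identity on \<open>X\<close>.\<close>

lemma cancel_sandwich:
  assumes "single_valued (f\<inverse>)" "single_valued t" "Domain f = X" "Range t = X" "h \<subseteq> X \<times> X"
  shows "f O (f\<inverse> O h O t\<inverse>) O t = h"
proof (rule set_eqI, clarify)
  fix x y
  show "(x, y) \<in> f O (f\<inverse> O h O t\<inverse>) O t \<longleftrightarrow> (x, y) \<in> h"
  proof
    assume "(x, y) \<in> f O (f\<inverse> O h O t\<inverse>) O t"
    then show "(x, y) \<in> h"
      using assms(1,2) unfolding single_valued_def by blast
  next
    assume "(x, y) \<in> h"
    moreover from this obtain a b where "(x, a) \<in> f" "(b, y) \<in> t"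
      using assms(3-5) by blast
    ultimately show "(x, y) \<in> f O (f\<inverse> O h O t\<inverse>) O t" by blast
  qed
qed

lemma sym_inv_monoid_closed:
  "f \<in> sym_inv_monoid X \<Longrightarrow> g \<in> sym_inv_monoid X \<Longrightarrow> f O g \<in> sym_inv_monoid X"
  "f \<in> sym_inv_monoid X \<Longrightarrow> f\<inverse> \<in> sym_inv_monoid X"
  using subsemigroup_sym_inv_monoid[of X]
  unfolding inverse_subsemigroup_def subsemigroup_def by simp_all

lemma mem_set_inverse_iff: "f \<in> set_inverse A \<longleftrightarrow> f\<inverse> \<in> A"
proof
  assume "f\<inverse> \<in> A"
  then show "f \<in> set_inverse A"
    unfolding set_inverse_def by (intro CollectI exI[of _ "f\<inverse>"]) simp
qed (auto simp: set_inverse_def)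

lemma subsemigroup_eq_sym_inv_monoid:
  assumes "infinite Y" "subsemigroup X U"
    and sym: "Sym Y \<subseteq> {restr g Y | g. g \<in> U}"
    and f: "f \<in> U" "Domain f = X" "moiety (Range f) Y"
    and t: "t \<in> U" "Range t = X" "moiety (Domain t) Y"
  shows "U = sym_inv_monoid X"
proof
  show sub: "U \<subseteq> sym_inv_monoid X"
    using assms by (simp add: subsemigroup_def)
  show "sym_inv_monoid X \<subseteq> U"
  proof
    fix h assume h: "h \<in> sym_inv_monoid X"
    define k where "k = f\<inverse> O h O t\<inverse>"
    have k: "k \<subseteq> Range f \<times> Domain t" by (auto simp: k_def)
    have "k \<in> sym_inv_monoid X"
      unfolding k_def using h f(1) t(1) sub by (blast intro: sym_inv_monoid_closed)
    \<comment> \<open>All points of \<open>k\<close> lie in the moieties \<open>Range f\<close> and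
      \<open>Domain t\<close> of \<open>Y\<close>.\<close>
    then have "k \<in> sym_inv_monoid Y"
      using k f(3) t(3) by (auto simp: sym_inv_monoid_iff moiety_def)
    then obtain p where p: "p \<in> Sym Y" "p \<inter> Range f \<times> Domain t = k"
      using ex_Sym_extending_chart assms(1) f(3) t(3) k by metis
    then obtain g where g: "g \<in> U" "restr g Y = p"
      using sym by blast
    have "f O g O t = f O k O t"
      using restr_sandwich[of f Y g p t] f(3) g(2) p(2) by (simp add: moiety_def)
    also have "\<dots> = h"
      unfolding k_def using h f t sub
      by (intro cancel_sandwich[where X = X]) (auto simp: sym_inv_monoid_iff subset_iff)
    finally show "h \<in> U"
      using f(1) t(1) g(1) assms(2) unfolding subsemigroup_def by metis
  qed
qed

lemma subsemigroup_set_inverse: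
  assumes "subsemigroup X U"
  shows "subsemigroup X (set_inverse U)"
  unfolding subsemigroup_def
proof (intro conjI ballI subsetI)
  fix f assume "f \<in> set_inverse U"
  then show "f \<in> sym_inv_monoid X"
    using assms sym_inv_monoid_closed(2)[of "f\<inverse>" X]
    by (auto simp: mem_set_inverse_iff subsemigroup_def)
next
  fix f g assume "f \<in> set_inverse U" "g \<in> set_inverse U"
  then show "f O g \<in> set_inverse U"
    using assms by (auto simp: mem_set_inverse_iff subsemigroup_def converse_relcomp)
qed

theorem theorem3p13:
  fixes X Y :: "'a set"
    and G :: "('a \<times> 'a) set set"
    and I :: "'i set"
    and M :: "'i \<Rightarrow> ('a \<times> 'a) set set"
  assumes "infinite X"
    and "inverse_subsemigroup X G"
    and "\<forall>i\<in>I. M i \<subseteq> sym_inv_monoid X"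
    and i: "\<forall>i\<in>I. G \<subseteq> M i"
    and ii: "\<forall>i\<in>I. proper_subsemigroup X (M i)"
    and iii: "\<forall>i\<in>I. \<forall>j\<in>I. i \<noteq> j \<longrightarrow> \<not> M i \<subseteq> M j"
    and iv: "\<forall>i\<in>I. \<exists>j\<in>I. M j = set_inverse (M i)"
    and v: "Y \<subseteq> X" "Y \<approx> X" "Sym Y \<subseteq> {restr g Y | g. g \<in> G}"
    and vi: "\<forall>U. subsemigroup X U \<and> G \<subseteq> U \<and> (\<forall>i\<in>I. \<not> U \<subseteq> M i) \<longrightarrow>
               (\<exists>f\<in>U. Domain f = X \<and> moiety (Range f) Y)"
  shows "{M i | i. i \<in> I} = {S. maximal_subsemigroup X S \<and> G \<subseteq> S}"
proof -
  have full: "U = sym_inv_monoid X"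
    if U: "subsemigroup X U" "G \<subseteq> U" "\<forall>i\<in>I. \<not> U \<subseteq> M i" for U
  proof -
    have "G \<subseteq> set_inverse U"
      using assms(2) U(2) by (auto simp: mem_set_inverse_iff inverse_subsemigroup_def)
    \<comment> \<open>Inverting such an inclusion would place \<open>U\<close> inside the inverse of
      \<open>M i\<close>, which by (iv) is itself a member of the family.\<close>
    moreover have "\<not> set_inverse U \<subseteq> M i" if "i \<in> I" for i
    proof
      assume sub: "set_inverse U \<subseteq> M i"
      obtain j where "j \<in> I" "M j = set_inverse (M i)"
        using iv \<open>i \<in> I\<close> by blast
      moreover have "U \<subseteq> set_inverse (M i)"
        using sub by (auto simp: mem_set_inverse_iff subset_iff)
      ultimately show False
        using U(3) by metis
    qed
    ultimately obtain s where s: "s \<in> set_inverse U" "Domain s = X" "moiety (Range s) Y"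
      using vi subsemigroup_set_inverse[OF U(1)] by meson
    obtain f where f: "f \<in> U" "Domain f = X" "moiety (Range f) Y"
      using vi U by meson
    have "infinite Y"
      using assms(1) v(2) eqpoll_finite_iff by blast
    moreover have "Sym Y \<subseteq> {restr g Y | g. g \<in> U}"
      using v(3) U(2) by blast
    \<comment> \<open>As \<open>s\<close> maps \<open>X\<close> onto a moiety of \<open>Y\<close>,
      its inverse lies in \<open>U\<close> and serves as \<open>t\<close>.\<close>
    ultimately show ?thesis
      using subsemigroup_eq_sym_inv_monoid[of Y X U f "s\<inverse>"] U(1) f s
      by (simp add: mem_set_inverse_iff)
  qed
  \<comment> \<open>The contrapositive of \<open>full\<close>; both inclusions of the theorem rest
    on it.\<close>
  have below: "\<exists>j\<in>I. T \<subseteq> M j" if "proper_subsemigroup X T" "G \<subseteq> T" for T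
    using that full[of T] unfolding proper_subsemigroup_def by blast
  show ?thesis
  proof (intro set_eqI iffI)
    fix S assume "S \<in> {M i | i. i \<in> I}"
    then obtain j where j: "j \<in> I" "S = M j" by blast
    have "T = M j" if "proper_subsemigroup X T" "M j \<subseteq> T" for T
    proof -
      \<comment> \<open>Now \<open>M j \<subseteq> T \<subseteq> M l\<close>, and the antichain
        condition (iii) forces \<open>l = j\<close>.\<close>
      obtain l where "l \<in> I" "T \<subseteq> M l"
        using below \<open>proper_subsemigroup X T\<close> \<open>M j \<subseteq> T\<close> i j(1) by (meson order_trans)
      then show ?thesis
        using iii j(1) \<open>M j \<subseteq> T\<close> by (metis order_antisym order_trans)
    qed
    moreover have "proper_subsemigroup X (M j)" "G \<subseteq> M j"
      using i ii j(1) by blast+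
    ultimately show "S \<in> {S. maximal_subsemigroup X S \<and> G \<subseteq> S}"
      unfolding j(2) maximal_subsemigroup_def by blast
  next
    fix S assume "S \<in> {S. maximal_subsemigroup X S \<and> G \<subseteq> S}"
    then have S: "proper_subsemigroup X S" "G \<subseteq> S" "\<And>T. proper_subsemigroup X T \<Longrightarrow> S \<subseteq> T \<Longrightarrow> T = S"
      by (auto simp: maximal_subsemigroup_def)
    then obtain j where j: "j \<in> I" "S \<subseteq> M j"
      using below by blast
    then have "M j = S"
      using S(3) ii by blast
    then show "S \<in> {M i | i. i \<in> I}"
      using j(1) by blast
  qed
qed

end
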